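(* In the setting fixed in the context, let $\nu>0$, $D=\sqrt{\sup_{x,y\in P}D_\phi(x,y)}$, and let $T\in\mathbb N$. Then the iterates $(x_t)$ of the Frank--Wolfe algorithm started at $x_0\in P$ with constant step-size $\gamma_t=\gamma:=1/(T+1)^{\frac1{1+\nu}}$ satisfy $$G_T:=\min_{0\le t\le T}\max_{v\in P}\langle\nabla f(x_t),x_t-v\rangle\le\frac{2\max\{h_0,LD^2\}}{(T+1)^{\frac{\nu}{1+\nu}}},$$ where $h_0=f(x_0)-f^*$ is the primal gap at $x_0$.
   Context: Setting ($f$ is not assumed convex). $C\subset\mathbb R^n$ is a nonempty open convex set. A kernel generating distance associated with $C$ is a proper lower semicontinuous convex function $\phi:\mathbb R^n\to(-\infty,+\infty]$ with $\operatorname{dom}\phi\subset\operatorname{cl}C$, $\operatorname{dom}\partial\phi=C$, and $\phi$ of class $C^1$ on $\operatorname{int}\operatorname{dom}\phi= C$. The Bregman distance is $D_\phi(x,y)=\phi(x)-\phi(y)-\langle\nabla\phi(y),x-y\rangle$. Standing assumptions: (i) $\phi$ is a kernel generating distance associated with $C$, $\operatorname{cl}C=\operatorname{cl}\operatorname{dom}\phi$, $\phi$ is strictly convex on $C$, and $\nu>0$ satisfies $D_\phi((1-\gamma)x+\gamma y,x)\le\gamma^{1+\nu}D_\phi(y,x)$ for all $x,y\in C$, $\gamma\in[0,1]$; (ii) $f:\mathbb R^n\to(-\infty,+\infty]$ is proper, lower semicontinuous, $\operatorname{dom}\phi\subset\operatorname{dom}f$, and $f$ is $C^1$ on $C$;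 (iii) the pair $(f,\phi)$ is $L$-smooth adaptable on $P$: $L>0$ and both $L\phi-f$ and $L\phi+f$ are convex on $P$; (iv) $P\subset\mathbb R^n$ is a nonempty compact convex set with $P\subset C$. Write $f^*=\min_{x\in P}f(x)$. Frank--Wolfe algorithm: given $x_0\in P$, for $t=0,1,\dots$ pick $v_t\in\operatorname{argmin}_{v\in P}\langle\nabla f(x_t),v\rangle$, a step-size $\gamma_t\in[0,1]$, and set $x_{t+1}=(1-\gamma_t)x_t+\gamma_tv_t$. *)

theory Defs
  imports "HOL-Analysis.Analysis"
begin

section \<open>Extended-real-valued functions\<close>

definition edom :: "('a \<Rightarrow> ereal) \<Rightarrow> 'a set" where
  "edom F = {x. F x < \<infinity>}"

definition eproper :: "('a \<Rightarrow> ereal) \<Rightarrow> bool" where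
  "eproper F \<longleftrightarrow> (\<forall>x. F x \<noteq> -\<infinity>) \<and> edom F \<noteq> {}"

definition lsc :: "('a::topological_space \<Rightarrow> ereal) \<Rightarrow> bool" where
  "lsc F \<longleftrightarrow> (\<forall>x. F x \<le> Liminf (at x) F)"

text \<open>The next two notions are only meant for functions that do not take the value
  \<open>-\<infinity>\<close>. Since \<open>0 * \<infinity> = 0\<close> in \<^typ>\<open>ereal\<close>, the endpoints
  \<open>u = 0\<close> and \<open>u = 1\<close> of the convexity inequality are trivial.\<close>

definition econvex :: "('a::real_vector \<Rightarrow> ereal) \<Rightarrow> bool" where
  "econvex F \<longleftrightarrow> (\<forall>x y. \<forall>u\<in>{0..1::real}.
     F ((1 - u) *\<^sub>R x + u *\<^sub>R y) \<le> ereal (1 - u) * F x + ereal u * F y)"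

definition strict_econvex_on :: "'a::real_vector set \<Rightarrow> ('a \<Rightarrow> ereal) \<Rightarrow> bool" where
  "strict_econvex_on S F \<longleftrightarrow> convex S \<and> (\<forall>x\<in>S. \<forall>y\<in>S. x \<noteq> y \<longrightarrow> (\<forall>u\<in>{0<..<1::real}.
     F ((1 - u) *\<^sub>R x + u *\<^sub>R y) < ereal (1 - u) * F x + ereal u * F y))"

text \<open>For a proper function the subdifferential is empty outside the domain, because the
  subgradient inequality then fails at every point of the domain.\<close>

definition subdifferential :: "('a::real_inner \<Rightarrow> ereal) \<Rightarrow> 'a \<Rightarrow> 'a set" where
  "subdifferential F x = {g. \<forall>y. F x + ereal (g \<bullet> (y - x)) \<le> F y}"

definition dom_subdifferential :: "('a::real_inner \<Rightarrow> ereal) \<Rightarrow> 'a set" where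
  "dom_subdifferential F = {x. subdifferential F x \<noteq> {}}"

text \<open>Differentiability goes through \<^const>\<open>real_of_ereal\<close>, which is only used on open sets
  on which the function is finite. There the gradient is unique, so \<open>THE\<close> is justified.\<close>

definition grad :: "('a::real_inner \<Rightarrow> ereal) \<Rightarrow> 'a \<Rightarrow> 'a" where
  "grad F x = (THE g. GDERIV (\<lambda>y. real_of_ereal (F y)) x :> g)"

definition C1_on :: "'a::real_inner set \<Rightarrow> ('a \<Rightarrow> ereal) \<Rightarrow> bool" where
  "C1_on U F \<longleftrightarrow> (\<forall>x\<in>U. \<bar>F x\<bar> \<noteq> \<infinity>) \<and>
     (\<exists>G. (\<forall>x\<in>U. GDERIV (\<lambda>y. real_of_ereal (F y)) x :> G x) \<and> continuous_on U G)"


section \<open>Kernels and Bregman distances\<close>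

definition kernel_generating_distance :: "'a::real_inner set \<Rightarrow> ('a \<Rightarrow> ereal) \<Rightarrow> bool" where
  "kernel_generating_distance C \<phi> \<longleftrightarrow>
     eproper \<phi> \<and> lsc \<phi> \<and> econvex \<phi> \<and>
     edom \<phi> \<subseteq> closure C \<and> dom_subdifferential \<phi> = C \<and>
     interior (edom \<phi>) = C \<and> C1_on (interior (edom \<phi>)) \<phi>"

definition bregman :: "('a::real_inner \<Rightarrow> ereal) \<Rightarrow> 'a \<Rightarrow> 'a \<Rightarrow> ereal" where
  "bregman \<phi> x y = \<phi> x - \<phi> y - ereal (grad \<phi> y \<bullet> (x - y))"

text \<open>Used for compact \<open>P\<close> inside a set on which \<open>\<phi>\<close> is \<open>C\<^sup>1\<close>; the supremum is then finite
  and nonnegative.\<close>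

definition bregman_diameter :: "('a::real_inner \<Rightarrow> ereal) \<Rightarrow> 'a set \<Rightarrow> real" where
  "bregman_diameter \<phi> P = sqrt (real_of_ereal (SUP (x, y)\<in>P \<times> P. bregman \<phi> x y))"

text \<open>Both functions are finite on the set \<open>P\<close> to which this is applied.\<close>

definition smooth_adaptable_on ::
  "'a::real_vector set \<Rightarrow> real \<Rightarrow> ('a \<Rightarrow> ereal) \<Rightarrow> ('a \<Rightarrow> ereal) \<Rightarrow> bool" where
  "smooth_adaptable_on P L f \<phi> \<longleftrightarrow>
     convex_on P (\<lambda>x. L * real_of_ereal (\<phi> x) - real_of_ereal (f x)) \<and>
     convex_on P (\<lambda>x. L * real_of_ereal (\<phi> x) + real_of_ereal (f x))"


section \<open>The Frank--Wolfe algorithm\<close>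

definition frank_wolfe ::
  "'a::real_inner set \<Rightarrow> ('a \<Rightarrow> ereal) \<Rightarrow> 'a \<Rightarrow> (nat \<Rightarrow> real) \<Rightarrow> (nat \<Rightarrow> 'a) \<Rightarrow> (nat \<Rightarrow> 'a) \<Rightarrow> bool"
  where
  "frank_wolfe P f x0 \<gamma> x v \<longleftrightarrow>
     x0 \<in> P \<and> x 0 = x0 \<and>
     (\<forall>t. is_arg_min (\<lambda>w. grad f (x t) \<bullet> w) (\<lambda>w. w \<in> P) (v t) \<and>
          \<gamma> t \<in> {0..1} \<and>
          x (Suc t) = (1 - \<gamma> t) *\<^sub>R x t + \<gamma> t *\<^sub>R v t)"

text \<open>For nonempty compact \<open>P\<close> the supremum below is a maximum, and if moreover \<open>f\<close> is
  finite and continuous on \<open>P\<close> then the infimum in \<open>primal_gap\<close> is a minimum.\<close>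

definition fw_gap :: "'a::real_inner set \<Rightarrow> ('a \<Rightarrow> ereal) \<Rightarrow> 'a \<Rightarrow> real" where
  "fw_gap P f x = (SUP v\<in>P. grad f x \<bullet> (x - v))"

definition primal_gap :: "'a set \<Rightarrow> ('a \<Rightarrow> ereal) \<Rightarrow> 'a \<Rightarrow> real" where
  "primal_gap P f x = real_of_ereal (f x - (INF y\<in>P. f y))"

end

theory Submission
  imports Defs
begin

text \<open>Convexity of \<open>L \<phi> - f\<close> yields the descent inequality
  \<open>f y \<le> f x + \<langle>\<nabla>f x, y - x\<rangle> + L D\<^sub>\<phi>(y, x)\<close>. Along a Frank--Wolfe step the scaling property bounds
  the last term by \<open>L D\<^sup>2 \<gamma>\<^sup>1\<^sup>+\<^sup>\<nu>\<close>, so \<open>\<gamma> g\<^sub>t \<le> f x\<^sub>t - f x\<^sub>t\<^sub>+\<^sub>1 + L D\<^sup>2 \<gamma>\<^sup>1\<^sup>+\<^sup>\<nu>\<close> for the gap \<open>g\<^sub>t\<close> at \<open>x\<^sub>t\<close>.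
  Summing over \<open>t \<le> T\<close> telescopes, and \<open>\<gamma>\<^sup>1\<^sup>+\<^sup>\<nu> = 1/(T+1)\<close> makes the error terms add up to
  \<open>L D\<^sup>2\<close>.\<close>

lemma GDERIV_unique:
  assumes "GDERIV h x :> g" "GDERIV h x :> g'"
  shows "g = g'"
proof -
  have "(\<lambda>u. u \<bullet> g) = (\<lambda>u. u \<bullet> g')"
    using assms unfolding gderiv_def by (rule has_derivative_unique)
  then show ?thesis
    by (metis vector_eq_ldot)
qed

text \<open>Uniqueness of gradients makes the \<open>THE\<close> in \<open>grad\<close> well
  defined, so any gradient of the real part can be identified with \<open>grad\<close>.\<close>

lemma GDERIV_real_of_ereal_grad:
  assumes "GDERIV (\<lambda>y. real_of_ereal (F y)) x :> g"
  shows "grad F x = g"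
  unfolding grad_def using assms
  by (rule the_equality) (metis assms GDERIV_unique)

lemma C1_on_finite: "C1_on U F \<Longrightarrow> x \<in> U \<Longrightarrow> ereal (real_of_ereal (F x)) = F x"
  unfolding C1_on_def by (auto simp: ereal_real)

lemma C1_on_GDERIV:
  assumes "C1_on U F" "x \<in> U"
  shows "GDERIV (\<lambda>y. real_of_ereal (F y)) x :> grad F x"
  using assms GDERIV_real_of_ereal_grad unfolding C1_on_def by metis

lemma C1_on_continuous_on_grad:
  assumes "C1_on U F"
  shows "continuous_on U (grad F)"
proof -
  obtain G where G: "\<forall>x\<in>U. GDERIV (\<lambda>y. real_of_ereal (F y)) x :> G x" "continuous_on U G"
    using assms unfolding C1_on_def by blast
  then show ?thesis
    using GDERIV_real_of_ereal_grad by (metis continuous_on_cong)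
qed

lemma C1_on_continuous_on:
  assumes "C1_on U F"
  shows "continuous_on U (\<lambda>y. real_of_ereal (F y))"
  using C1_on_GDERIV[OF assms]
  by (meson GDERIV_DERIV_compose continuous_at_imp_continuous_on gderiv_def has_derivative_continuous)

lemma bregman_eq_ereal:
  assumes "C1_on U F" "x \<in> U" "y \<in> U"
  shows "bregman F x y =
    ereal (real_of_ereal (F x) - real_of_ereal (F y) - grad F y \<bullet> (x - y))"
  unfolding bregman_def
  by (subst (1 2) C1_on_finite[OF assms(1), symmetric]) (use assms in auto)

text \<open>\<open>real_of_ereal\<close> would send an infinite supremum to 0. Compactness of
  \<open>P \<times> P\<close> and joint continuity of the Bregman distance there show that the
  supremum is attained, hence finite.\<close>

lemma bregman_le_diameter:
  assumes F: "C1_on U F" and P: "compact P" "P \<subseteq> U" and xy: "x \<in> P" "y \<in> P"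
  shows "bregman F x y \<le> ereal ((bregman_diameter F P)\<^sup>2)"
proof -
  define d where "d = (\<lambda>(x, y). real_of_ereal (F x) - real_of_ereal (F y) - grad F y \<bullet> (x - y))"
  have eq: "bregman F a b = ereal (d (a, b))" if "a \<in> P" "b \<in> P" for a b
    using bregman_eq_ereal[OF F, of a b] that P by (auto simp: d_def)
  have c1: "continuous_on P (\<lambda>y. real_of_ereal (F y))" "continuous_on P (grad F)"
    using C1_on_continuous_on[OF F] C1_on_continuous_on_grad[OF F] P(2) continuous_on_subset
    by blast+
  have cf: "continuous_on (P \<times> P) (\<lambda>z. real_of_ereal (F (fst z)))"
    by (rule continuous_on_compose2[OF c1(1)]) (auto intro!: continuous_intros)
  have cs: "continuous_on (P \<times> P) (\<lambda>z. real_of_ereal (F (snd z)))"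
    by (rule continuous_on_compose2[OF c1(1)]) (auto intro!: continuous_intros)
  have cg: "continuous_on (P \<times> P) (\<lambda>z. grad F (snd z))"
    by (rule continuous_on_compose2[OF c1(2)]) (auto intro!: continuous_intros)
  have "continuous_on (P \<times> P) d"
    unfolding d_def case_prod_unfold by (intro continuous_intros cf cs cg)
  then obtain z where z: "z \<in> P \<times> P" "\<And>w. w \<in> P \<times> P \<Longrightarrow> d w \<le> d z"
    using continuous_attains_sup[of "P \<times> P" d] compact_Times[OF P(1) P(1)] xy
    by (metis SigmaI empty_iff)
  have "(SUP (x, y)\<in>P \<times> P. bregman F x y) = (SUP w\<in>P \<times> P. ereal (d w))"
    by (rule SUP_cong) (auto simp: eq)
  also have "\<dots> = ereal (d z)"
    by (rule antisym) (use z in \<open>auto intro!: SUP_least SUP_upper\<close>)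
  finally have sup: "(SUP (x, y)\<in>P \<times> P. bregman F x y) = ereal (d z)" .
  \<comment> \<open>The Bregman distance vanishes on the diagonal; nonnegativity of the maximum lets
    the square cancel the \<open>sqrt\<close> in \<open>bregman_diameter\<close>.\<close>
  have "0 \<le> d z"
    using z(2)[of "(x, x)"] xy by (simp add: d_def)
  then have "(bregman_diameter F P)\<^sup>2 = d z"
    by (simp add: bregman_diameter_def sup)
  then show ?thesis
    using z(2)[of "(x, y)"] xy by (simp add: eq)
qed

text \<open>The infimum is attained on the compact set \<open>P\<close>, so
  \<open>primal_gap\<close> is a genuine difference of reals. With a late iterate as
  \<open>y\<close> this bounds a telescoped sum.\<close>

lemma primal_gap_ge_diff:
  assumes f: "C1_on U f" and P: "compact P" "P \<subseteq> U" and xy: "x \<in> P" "y \<in> P"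
  shows "real_of_ereal (f x) - real_of_ereal (f y) \<le> primal_gap P f x"
proof -
  let ?f = "\<lambda>y. real_of_ereal (f y)"
  have eq: "f a = ereal (?f a)" if "a \<in> P" for a
    using C1_on_finite[OF f] that P by (metis subsetD)
  have "continuous_on P ?f"
    using C1_on_continuous_on[OF f] P(2) continuous_on_subset by blast
  then obtain p where p: "p \<in> P" "\<And>w. w \<in> P \<Longrightarrow> ?f p \<le> ?f w"
    using continuous_attains_inf[of P ?f] P xy by auto
  have "(INF y\<in>P. f y) = f p"
    \<comment> \<open>Minimality of \<open>p\<close> is known between reals; reversing
      \<open>ereal_less_eq(3)\<close> lifts it to \<open>ereal\<close>, where the infimum is
      taken.\<close>
    by (rule antisym) (use p eq in \<open>auto intro!: INF_lower INF_greatest simp: ereal_less_eq(3)[symmetric] simp del: ereal_less_eq(3)\<close>)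
  then have "primal_gap P f x = real_of_ereal (ereal (?f x) - ereal (?f p))"
    unfolding primal_gap_def using eq p(1) xy by metis
  then show ?thesis
    using p(2)[OF xy(2)] by simp
qed

text \<open>By convexity, the difference quotients of \<open>h\<close> along the segment from
  \<open>x\<close> to \<open>y\<close> are at most \<open>h y - h x\<close>; their limit at
  \<open>x\<close> is the directional derivative.\<close>

lemma convex_on_GDERIV_above_tangent:
  fixes h :: "'a::real_inner \<Rightarrow> real"
  assumes h: "convex_on S h" and xy: "x \<in> S" "y \<in> S" and g: "GDERIV h x :> g"
  shows "h x + g \<bullet> (y - x) \<le> h y"
proof -
  have "((\<lambda>s. h (x + s *\<^sub>R (y - x))) has_derivative (\<lambda>s. (s *\<^sub>R (y - x)) \<bullet> g)) (at 0)"
    by (rule has_derivative_compose[where g = h and f = "\<lambda>s. x + s *\<^sub>R (y - x)"])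
       (use g in \<open>auto simp: gderiv_def intro!: derivative_eq_intros\<close>)
  then have "((\<lambda>s. h (x + s *\<^sub>R (y - x))) has_real_derivative (g \<bullet> (y - x))) (at 0)"
    by (simp add: has_field_derivative_def inner_commute mult.commute[of _ "_ \<bullet> _"])
  \<comment> \<open>The limit is restricted to positive \<open>s\<close>: for small such
    \<open>s\<close> the point lies on the segment, where convexity applies.\<close>
  then have "((\<lambda>s. (h (x + s *\<^sub>R (y - x)) - h x) / s) \<longlongrightarrow> g \<bullet> (y - x)) (at_right 0)"
    by (auto simp: DERIV_def intro: filterlim_mono[OF _ order_refl at_le])
  moreover have "\<forall>\<^sub>F s in at_right 0. (h (x + s *\<^sub>R (y - x)) - h x) / s \<le> h y - h x"
  proof (rule eventually_at_rightI[of 0 1])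
    fix s :: real assume s: "s \<in> {0<..<1}"
    have "h (x + s *\<^sub>R (y - x)) = h ((1 - s) *\<^sub>R x + s *\<^sub>R y)"
      by (simp add: algebra_simps)
    also have "\<dots> \<le> (1 - s) * h x + s * h y"
      using convex_onD[OF h, of s x y] s xy by auto
    finally show "(h (x + s *\<^sub>R (y - x)) - h x) / s \<le> h y - h x"
      using s by (simp add: field_simps)
  qed simp
  ultimately have "g \<bullet> (y - x) \<le> h y - h x"
    by (intro tendsto_upperbound) auto
  then show ?thesis by simp
qed

text \<open>This is the tangent inequality at \<open>x\<close> for \<open>L * \<phi> - f\<close>,
  with the terms in \<open>\<phi>\<close> collected into \<open>L\<close> times the Bregman
  distance.\<close>

lemma smooth_adaptable_descent:
  fixes f \<phi> :: "'a::real_inner \<Rightarrow> ereal"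
  assumes f: "C1_on U f" and phi: "C1_on U \<phi>" and P: "P \<subseteq> U"
    and smad: "smooth_adaptable_on P L f \<phi>" and xy: "x \<in> P" "y \<in> P"
  shows "real_of_ereal (f y) \<le> real_of_ereal (f x) + grad f x \<bullet> (y - x)
    + L * real_of_ereal (bregman \<phi> y x)"
proof -
  have "GDERIV (\<lambda>z. L * real_of_ereal (\<phi> z) - real_of_ereal (f z)) x :> L *\<^sub>R grad \<phi> x - grad f x"
    using C1_on_GDERIV[OF f, of x] C1_on_GDERIV[OF phi, of x] P xy
    by (auto simp: gderiv_def inner_diff_right intro!: derivative_eq_intros)
  moreover have "convex_on P (\<lambda>z. L * real_of_ereal (\<phi> z) - real_of_ereal (f z))"
    using smad by (simp add: smooth_adaptable_on_def)
  ultimately show ?thesis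
    using convex_on_GDERIV_above_tangent xy bregman_eq_ereal[OF phi, of y x] P
    by (fastforce simp: inner_diff_left algebra_simps)
qed

lemma frank_wolfe_iterates_mem:
  assumes "frank_wolfe P f x0 \<gamma> x v" "convex P"
  shows "x t \<in> P"
proof (induction t)
  case 0
  then show ?case using assms by (simp add: frank_wolfe_def)
next
  case (Suc t)
  then show ?case using assms
    by (auto simp: frank_wolfe_def is_arg_min_def intro!: convexD_alt)
qed

text \<open>Minimising the linear form over \<open>P\<close> amounts to maximising the expression in
  the gap.\<close>

lemma fw_gap_le_argmin:
  assumes "is_arg_min (\<lambda>w. grad f x \<bullet> w) (\<lambda>w. w \<in> P) v"
  shows "fw_gap P f x \<le> grad f x \<bullet> (x - v)"
  unfolding fw_gap_def
  by (rule cSUP_least) (use assms in \<open>auto simp: is_arg_min_linorder inner_diff_right\<close>)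

lemma frank_wolfe_step:
  fixes f \<phi> :: "'a::real_inner \<Rightarrow> ereal"
  assumes f: "C1_on C f" and phi: "C1_on C \<phi>"
    and scaling: "\<And>a b s. a \<in> C \<Longrightarrow> b \<in> C \<Longrightarrow> s \<in> {0..1} \<Longrightarrow>
      bregman \<phi> ((1 - s) *\<^sub>R a + s *\<^sub>R b) a \<le> ereal (s powr (1 + \<nu>)) * bregman \<phi> b a"
    and smad: "L \<ge> 0" "smooth_adaptable_on P L f \<phi>"
    and P: "compact P" "convex P" "P \<subseteq> C"
    and FW: "frank_wolfe P f x0 \<gamma> x v"
  shows "\<gamma> t * fw_gap P f (x t) \<le> real_of_ereal (f (x t)) - real_of_ereal (f (x (Suc t)))
    + L * \<gamma> t powr (1 + \<nu>) * (bregman_diameter \<phi> P)\<^sup>2"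
proof -
  note xP = frank_wolfe_iterates_mem[OF FW P(2)]
  let ?D2 = "(bregman_diameter \<phi> P)\<^sup>2"
  have v: "is_arg_min (\<lambda>w. grad f (x t) \<bullet> w) (\<lambda>w. w \<in> P) (v t)"
    and g: "\<gamma> t \<in> {0..1}" and suc: "x (Suc t) = (1 - \<gamma> t) *\<^sub>R x t + \<gamma> t *\<^sub>R v t"
    using FW by (auto simp: frank_wolfe_def)
  have vP: "v t \<in> P" using v by (simp add: is_arg_min_def)
  \<comment> \<open>The scaling property is used with base point \<open>x t\<close> and direction
    towards \<open>v t\<close>; the diameter then bounds the remaining Bregman distance.\<close>
  have "bregman \<phi> (x (Suc t)) (x t) \<le> ereal (\<gamma> t powr (1 + \<nu>)) * bregman \<phi> (v t) (x t)"
    unfolding suc using scaling P(3) xP vP g by blast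
  also have "\<dots> \<le> ereal (\<gamma> t powr (1 + \<nu>)) * ereal ?D2"
    by (intro ereal_mult_left_mono bregman_le_diameter[OF phi P(1,3) vP xP]) simp
  finally have "real_of_ereal (bregman \<phi> (x (Suc t)) (x t)) \<le> \<gamma> t powr (1 + \<nu>) * ?D2"
    using bregman_eq_ereal[OF phi, of "x (Suc t)" "x t"] xP P(3) by (auto simp: subset_iff)
  then have "L * real_of_ereal (bregman \<phi> (x (Suc t)) (x t)) \<le> L * \<gamma> t powr (1 + \<nu>) * ?D2"
    using mult_left_mono[OF _ smad(1)] by (simp add: mult.assoc)
  \<comment> \<open>The displacement is \<open>\<gamma> t\<close> times \<open>v t - x t\<close>, so
    the linear term of the descent inequality is minus the scaled gap.\<close>
  moreover have "grad f (x t) \<bullet> (x (Suc t) - x t) = - (\<gamma> t * (grad f (x t) \<bullet> (x t - v t)))"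
    by (simp add: suc algebra_simps)
  moreover have "\<gamma> t * fw_gap P f (x t) \<le> \<gamma> t * (grad f (x t) \<bullet> (x t - v t))"
    using fw_gap_le_argmin[OF v] g by (intro mult_left_mono) auto
  ultimately show ?thesis
    using smooth_adaptable_descent[OF f phi P(3) smad(2) xP xP, of "Suc t" t] by linarith
qed

theorem theoremE1:
  fixes C P :: "(real ^ 'n) set"
    and \<phi> f :: "real ^ 'n \<Rightarrow> ereal"
    and L \<nu> :: real
    and T :: nat
    and x0 :: "real ^ 'n"
    and \<gamma> :: "nat \<Rightarrow> real"
    and x v :: "nat \<Rightarrow> real ^ 'n"
  assumes C: "C \<noteq> {}" "open C" "convex C"
    and kernel: "kernel_generating_distance C \<phi>"
    and cl_dom: "closure C = closure (edom \<phi>)"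
    and strict: "strict_econvex_on C \<phi>"
    and nu_pos: "\<nu> > 0"
    and scaling: "\<And>a b s. a \<in> C \<Longrightarrow> b \<in> C \<Longrightarrow> s \<in> {0..1} \<Longrightarrow>
      bregman \<phi> ((1 - s) *\<^sub>R a + s *\<^sub>R b) a \<le> ereal (s powr (1 + \<nu>)) * bregman \<phi> b a"
    and f: "eproper f" "lsc f" "edom \<phi> \<subseteq> edom f" "C1_on C f"
    and smad: "L > 0" "smooth_adaptable_on P L f \<phi>"
    and P: "P \<noteq> {}" "compact P" "convex P" "P \<subseteq> C"
    and FW: "frank_wolfe P f x0 \<gamma> x v"
    and step: "\<And>t. \<gamma> t = 1 / (real T + 1) powr (1 / (1 + \<nu>))"
  shows "Min ((\<lambda>t. fw_gap P f (x t)) ` {0..T})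
    \<le> 2 * max (primal_gap P f x0) (L * (bregman_diameter \<phi> P)\<^sup>2)
        / (real T + 1) powr (\<nu> / (1 + \<nu>))"
proof -
  define m where "m = Min ((\<lambda>t. fw_gap P f (x t)) ` {0..T})"
  define c where "c = 1 / (real T + 1) powr (1 / (1 + \<nu>))"
  define K where "K = L * (bregman_diameter \<phi> P)\<^sup>2"
  define F where "F = (\<lambda>t. real_of_ereal (f (x t)))"
  have phi: "C1_on C \<phi>"
    using kernel by (auto simp: kernel_generating_distance_def)
  note xP = frank_wolfe_iterates_mem[OF FW P(3)]
  have c_powr: "c powr (1 + \<nu>) = 1 / (real T + 1)"
    using nu_pos by (simp add: c_def powr_divide powr_powr)
  have "c * m \<le> F t - F (Suc t) + K / (real T + 1)" if "t \<le> T" for t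
  proof -
    have "m \<le> fw_gap P f (x t)"
      unfolding m_def using that by (intro Min_le) auto
    then have "c * m \<le> c * fw_gap P f (x t)"
      by (intro mult_left_mono) (auto simp: c_def)
    also have "\<dots> \<le> F t - F (Suc t) + K / (real T + 1)"
      using frank_wolfe_step[OF f(4) phi scaling _ smad(2) P(2,3,4) FW, of t] smad(1)
      unfolding step c_def[symmetric] c_powr by (simp add: F_def K_def)
    finally show ?thesis .
  qed
  \<comment> \<open>There are \<open>T + 1\<close> summands, matching the indices
    \<open>0..T\<close> of the minimum, so the telescoped sum ends at the iterate
    \<open>Suc T\<close>.\<close>
  then have "(\<Sum>t<Suc T. c * m) \<le> (\<Sum>t<Suc T. F t - F (Suc t) + K / (real T + 1))"
    by (intro sum_mono) auto
  also have "\<dots> = F 0 - F (Suc T) + K"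
    by (simp only: sum.distrib sum_lessThan_telescope') (simp add: field_simps)
  \<comment> \<open>The final iterate still lies in \<open>P\<close>, so its value is at least the
    minimum of \<open>f\<close> over \<open>P\<close>.\<close>
  also have "\<dots> \<le> primal_gap P f x0 + K"
    using primal_gap_ge_diff[OF f(4) P(2,4) xP xP, of 0 "Suc T"] FW
    by (simp add: F_def frank_wolfe_def)
  \<comment> \<open>The factor 2 of the bound comes from replacing both summands by their
    maximum.\<close>
  also have "\<dots> \<le> 2 * max (primal_gap P f x0) K"
    by simp
  finally have "((real T + 1) * c) * m \<le> 2 * max (primal_gap P f x0) K"
    by (simp add: algebra_simps)
  \<comment> \<open>The \<open>T + 1\<close> copies of \<open>c\<close> produce the exponent
    \<open>1 - 1 / (1 + \<nu>)\<close>, which is the claimed rate.\<close>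
  moreover have "(real T + 1) * c = (real T + 1) powr (\<nu> / (1 + \<nu>))"
  proof -
    have "(real T + 1) * c = (real T + 1) powr (1 - 1 / (1 + \<nu>))"
      by (simp add: c_def powr_diff)
    also have "1 - 1 / (1 + \<nu>) = \<nu> / (1 + \<nu>)"
      using nu_pos by (simp add: field_simps)
    finally show ?thesis .
  qed
  ultimately show ?thesis
    unfolding m_def[symmetric] K_def[symmetric] by (simp add: pos_le_divide_eq mult.commute)
qed

end
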